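(* Let $X$ and $Y$ be linearly ordered sets which, with their interval topologies, are compact metrizable spaces. Then the set $M_+(X,Y)$ of all linear order preserving maps $X\to Y$, equipped with the pointwise topology (inherited from $Y^X$), is first countable (and compact).
   Context: The interval topology of a linear order $\leq$ on a set is generated by the subbase of all rays $(a,\to)=\{x:a<x\}$ and $(\leftarrow,b)=\{x:x<b\}$. A map $f$ between linearly ordered sets is linear order preserving (LOP) if $x\leq x'$ implies $f(x)\leq f(x')$; it is not assumed to be continuous. *)

theory Defs
  imports "HOL-Analysis.Analysis"
begin

definition upper_ray :: "'a set \<Rightarrow> 'a rel \<Rightarrow> 'a \<Rightarrow> 'a set"
  where "upper_ray X r a = {x \<in> X. (a, x) \<in> r \<and> x \<noteq> a}"

definition lower_ray :: "'a set \<Rightarrow> 'a rel \<Rightarrow> 'a \<Rightarrow> 'a set"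
  where "lower_ray X r b = {x \<in> X. (x, b) \<in> r \<and> x \<noteq> b}"

(* The rays need not cover X (they are all empty when X is a singleton), whereas
   topology_generated_by takes the union of the subbase as the underlying space.
   Hence X itself, the empty intersection of rays, is added explicitly. *)
definition interval_topology :: "'a set \<Rightarrow> 'a rel \<Rightarrow> 'a topology"
  where "interval_topology X r =
    topology_generated_by (insert X (upper_ray X r ` X \<union> lower_ray X r ` X))"

lemma topspace_interval_topology [simp]: "topspace (interval_topology X r) = X"
  by (auto simp: interval_topology_def topology_generated_by_topspace
      upper_ray_def lower_ray_def)

lemma interval_topology_UNIV:
  "interval_topology (UNIV :: 'a::linorder_topology set) {(x, y). x \<le> y} = euclidean"
proof -
  let ?R = "range greaterThan \<union> range lessThan :: 'a set set"
  have rays: "upper_ray UNIV {(x, y). x \<le> y} = (greaterThan :: 'a \<Rightarrow> _)"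
    "lower_ray UNIV {(x, y). x \<le> y} = (lessThan :: 'a \<Rightarrow> _)"
    by (auto simp: fun_eq_iff upper_ray_def lower_ray_def)
  have "generate_topology_on (insert UNIV ?R) U \<longleftrightarrow> open U" for U :: "'a set"
  proof
    assume "generate_topology_on (insert UNIV ?R) U"
    then show "open U" by induction auto
  next
    assume "open U"
    then have "generate_topology ?R U" by (simp add: open_generated_order Un_commute)
    then show "generate_topology_on (insert UNIV ?R) U"
      by induction (auto intro: generate_topology_on.intros)
  qed
  then show ?thesis
    by (simp add: interval_topology_def rays topology_eq openin_topology_generated_by_iff)
qed

(* Maps X \<rightarrow> Y are represented by the extensional functions X \<rightarrow>\<^sub>E Y,
   which form the underlying set of the product topology over X. *)
definition LOP_maps :: "'a set \<Rightarrow> 'a rel \<Rightarrow> 'b set \<Rightarrow> 'b rel \<Rightarrow> ('a \<Rightarrow> 'b) set"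
  where "LOP_maps X r Y s =
    {f \<in> X \<rightarrow>\<^sub>E Y. monotone_on X (\<lambda>x x'. (x, x') \<in> r) (\<lambda>y y'. (y, y') \<in> s) f}"

definition LOP_topology :: "'a set \<Rightarrow> 'a rel \<Rightarrow> 'b set \<Rightarrow> 'b rel \<Rightarrow> ('a \<Rightarrow> 'b) topology"
  where "LOP_topology X r Y s =
    subtopology (product_topology (\<lambda>_. interval_topology Y s) X) (LOP_maps X r Y s)"

lemma topspace_LOP_topology [simp]: "topspace (LOP_topology X r Y s) = LOP_maps X r Y s"
  by (auto simp: LOP_topology_def LOP_maps_def)

end

theory Submission
  imports Defs
begin

text \<open>
  Call \<open>x\<close> a left jump of a monotone map \<open>f\<close> if some \<open>p < f x\<close> bounds all values \<open>f a\<close> with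
  \<open>a < x\<close>. The gaps \<open>(p, f x]\<close> at different left jumps are disjoint and each of them meets a
  countable order-dense subset of \<open>Y\<close>, so left jumps are countable; by reversing the orders, so
  are right jumps. Let \<open>A\<close> consist of the jumps of \<open>f\<close> and a countable order-dense subset
  of \<open>X\<close>. If \<open>p < f x\<close>, then \<open>p < f d\<close> for some \<open>d \<le> x\<close> in \<open>A\<close>, and every monotone \<open>g\<close> with
  \<open>p < g d\<close> satisfies \<open>p < g x\<close>. Hence the coordinates in \<open>A\<close> alone determine
  the neighbourhoods of \<open>f\<close>, and there are countably many basic conditions on them. Compactness
  holds because the order of \<open>Y\<close> is closed, so that the monotone maps form a closed subset of the
  compact product.
\<close>

section \<open>Second countability of compact metrizable spaces\<close>

text \<open>Total boundedness gives a finite net for each radius \<open>1 / (n + 1)\<close>; the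
  balls of that radius about the points of all these nets form a countable base.\<close>

lemma compact_metrizable_imp_second_countable:
  assumes "compact_space T" and "metrizable_space T"
  shows "second_countable T"
proof -
  obtain M d where "Metric_space M d" and T: "T = Metric_space.mtopology M d"
    using assms(2) unfolding metrizable_space_def by blast
  then interpret Metric_space M d by simp
  have "mtotally_bounded M"
    using assms(1) T compactin_imp_mtotally_bounded by (simp add: compact_space_def)
  then have "\<forall>n. \<exists>K. finite K \<and> K \<subseteq> M \<and> M \<subseteq> (\<Union>x\<in>K. mball x (inverse (real (Suc n))))"
    unfolding mtotally_bounded_def by simp
  then obtain K where K: "\<And>n. finite (K n)" "\<And>n. K n \<subseteq> M"
    "\<And>n. M \<subseteq> (\<Union>x\<in>K n. mball x (inverse (real (Suc n))))"
    by metis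
  define \<B> where "\<B> = (\<Union>n. (\<lambda>x. mball x (inverse (real (Suc n)))) ` K n)"
  have "countable \<B>"
    using K(1) by (auto simp: \<B>_def intro: countable_finite)
  moreover have "openin T V" if "V \<in> \<B>" for V
    using that by (auto simp: \<B>_def T)
  moreover have "\<exists>V\<in>\<B>. x \<in> V \<and> V \<subseteq> U" if U: "openin T U" "x \<in> U" for U x
  proof -
    obtain e where e: "e > 0" "mball x e \<subseteq> U" and x: "x \<in> M"
      using U unfolding T openin_mtopology by blast
    \<comment> \<open>Half of \<open>e\<close> pays for the distance from \<open>x\<close> to the
      net point \<open>y\<close>, the other half for the distance from \<open>y\<close> to any point
      of its ball.\<close>
    obtain n where n: "inverse (real (Suc n)) < e / 2"
      using reals_Archimedean[of "e / 2"] e by auto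
    obtain y where y: "y \<in> K n" "x \<in> mball y (inverse (real (Suc n)))"
      using K(3)[of n] x by blast
    have "mball y (inverse (real (Suc n))) \<subseteq> mball x e"
    proof
      fix z assume "z \<in> mball y (inverse (real (Suc n)))"
      then show "z \<in> mball x e"
        using y(2) n triangle[of x y z] commute[of x y] by auto
    qed
    then show ?thesis
      using y e(2) unfolding \<B>_def by blast
  qed
  ultimately show ?thesis
    unfolding second_countable_def by blast
qed

lemma second_countableE:
  assumes "second_countable T"
  obtains \<B> where "countable \<B>" and "\<And>V. V \<in> \<B> \<Longrightarrow> openin T V"
    and "\<And>U x. openin T U \<Longrightarrow> x \<in> U \<Longrightarrow> \<exists>V\<in>\<B>. x \<in> V \<and> V \<subseteq> U"
proof -
  from assms obtain \<B> where \<B>: "countable \<B>" "\<forall>V\<in>\<B>. openin T V"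
    "\<forall>U x. openin T U \<and> x \<in> U \<longrightarrow> (\<exists>V\<in>\<B>. x \<in> V \<and> V \<subseteq> U)"
    unfolding second_countable_def by (elim exE conjE)
  show thesis
  proof (rule that[OF \<B>(1)])
    show "openin T V" if "V \<in> \<B>" for V
      using \<B>(2) that ..
    show "\<exists>V\<in>\<B>. x \<in> V \<and> V \<subseteq> U" if "openin T U" "x \<in> U" for U x
      using \<B>(3) that by simp
  qed
qed

section \<open>Linear orders as relations, and their rays\<close>

lemma linear_order_on_mem:
  assumes "linear_order_on X r" and "(a, b) \<in> r"
  shows "a \<in> X" and "b \<in> X"
  using assms by (auto simp: order_on_defs)

lemma linear_order_on_refl:
  assumes "linear_order_on X r" and "a \<in> X"
  shows "(a, a) \<in> r"
  using assms by (auto simp: order_on_defs refl_on_def)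

lemma linear_order_on_trans:
  assumes "linear_order_on X r" and "(a, b) \<in> r" and "(b, c) \<in> r"
  shows "(a, c) \<in> r"
  using assms by (auto simp: order_on_defs dest: transD)

lemma linear_order_on_antisym:
  assumes "linear_order_on X r" and "(a, b) \<in> r" and "(b, a) \<in> r"
  shows "a = b"
  using assms by (auto simp: order_on_defs dest: antisymD)

lemma linear_order_on_linear:
  assumes "linear_order_on X r" and "a \<in> X" and "b \<in> X"
  shows "(a, b) \<in> r \<or> (b, a) \<in> r"
  using assms by (cases "a = b") (auto simp: order_on_defs refl_on_def total_on_def)

lemma upper_ray_upward:
  assumes X: "linear_order_on X r" and "b \<in> upper_ray X r a" and "(b, c) \<in> r"
  shows "c \<in> upper_ray X r a"
proof -
  have "(a, b) \<in> r" "b \<noteq> a"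
    using assms(2) by (simp_all add: upper_ray_def)
  then show ?thesis
    using linear_order_on_trans[OF X _ assms(3)] linear_order_on_mem(2)[OF X assms(3)]
      linear_order_on_antisym[OF X, of a b] assms(3)
    by (auto simp: upper_ray_def)
qed

lemma lower_ray_downward:
  assumes X: "linear_order_on X r" and "b \<in> lower_ray X r a" and "(c, b) \<in> r"
  shows "c \<in> lower_ray X r a"
proof -
  have "(b, a) \<in> r" "b \<noteq> a"
    using assms(2) by (simp_all add: lower_ray_def)
  then show ?thesis
    using linear_order_on_trans[OF X assms(3)] linear_order_on_mem(1)[OF X assms(3)]
      linear_order_on_antisym[OF X, of a b] assms(3)
    by (auto simp: lower_ray_def)
qed

lemma rays_disjoint:
  assumes X: "linear_order_on X r"
  shows "lower_ray X r a \<inter> upper_ray X r a = {}"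
  using linear_order_on_antisym[OF X, of a] by (auto simp: upper_ray_def lower_ray_def)

lemma openin_upper_ray:
  assumes "a \<in> X"
  shows "openin (interval_topology X r) (upper_ray X r a)"
  using assms unfolding interval_topology_def
  by (auto intro: topology_generated_by_Basis)

lemma openin_lower_ray:
  assumes "a \<in> X"
  shows "openin (interval_topology X r) (lower_ray X r a)"
  using assms unfolding interval_topology_def
  by (auto intro: topology_generated_by_Basis)

text \<open>Together with \<open>LOP_maps_converse\<close> this provides the left-right symmetry:
  reversing both orders changes neither the topologies nor the set of monotone maps.\<close>

lemma interval_topology_converse: "interval_topology X (r\<inverse>) = interval_topology X r"
proof -
  have "upper_ray X (r\<inverse>) = lower_ray X r" "lower_ray X (r\<inverse>) = upper_ray X r"
    by (auto simp: fun_eq_iff upper_ray_def lower_ray_def)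
  then show ?thesis
    by (simp add: interval_topology_def Un_commute)
qed

lemma LOP_maps_converse: "LOP_maps X (r\<inverse>) Y (s\<inverse>) = LOP_maps X r Y s"
  by (auto simp: LOP_maps_def monotone_on_def)

section \<open>Order-dense sets and jumps\<close>

text \<open>Density is stated for half-open intervals \<open>(p, q]\<close> so that it makes sense
  across a gap, where only \<open>q\<close> itself can be found. Hence \<open>C\<close> collects
  from each basic open set both an arbitrary point and the least element, if there is one.\<close>

lemma countable_order_dense:
  assumes X: "linear_order_on X r" and "second_countable (interval_topology X r)"
  obtains C where "countable C" and "C \<subseteq> X"
    and "\<And>p q. (p, q) \<in> r \<Longrightarrow> p \<noteq> q \<Longrightarrow> \<exists>c\<in>C. (p, c) \<in> r \<and> c \<noteq> p \<and> (c, q) \<in> r"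
proof -
  obtain \<B> where \<B>: "countable \<B>" "\<And>V. V \<in> \<B> \<Longrightarrow> openin (interval_topology X r) V"
    and base: "\<And>U x. openin (interval_topology X r) U \<Longrightarrow> x \<in> U \<Longrightarrow> \<exists>V\<in>\<B>. x \<in> V \<and> V \<subseteq> U"
    using second_countableE[OF assms(2)] by metis
  \<comment> \<open>Without a least element of \<open>V\<close> the value is unspecified, as is the
    \<open>SOME\<close> below for empty \<open>V\<close>; intersecting \<open>C\<close> with
    \<open>X\<close> makes such values harmless.\<close>
  define least where "least V = (THE x. x \<in> V \<and> (\<forall>y\<in>V. (x, y) \<in> r))" for V
  define C where "C = X \<inter> ((\<lambda>V. SOME x. x \<in> V) ` \<B> \<union> least ` \<B>)"
  show thesis
  proof
    show "countable C"
      using \<B>(1) unfolding C_def by auto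
    show "C \<subseteq> X"
      by (simp add: C_def)
    fix p q assume pq: "(p, q) \<in> r" "p \<noteq> q"
    note mem = linear_order_on_mem[OF X pq(1)]
    show "\<exists>c\<in>C. (p, c) \<in> r \<and> c \<noteq> p \<and> (c, q) \<in> r"
    proof (cases "upper_ray X r p \<inter> lower_ray X r q = {}")
      case True
      \<comment> \<open>A basic neighbourhood of \<open>q\<close> inside \<open>(p, \<rightarrow>) = [q, \<rightarrow>)\<close> has least element \<open>q\<close>.\<close>
      have "q \<in> upper_ray X r p"
        using pq mem by (simp add: upper_ray_def)
      then obtain V where V: "V \<in> \<B>" "q \<in> V" "V \<subseteq> upper_ray X r p"
        using base[OF openin_upper_ray[OF mem(1)]] by blast
      have "(q, y) \<in> r" if "y \<in> V" for y
      proof -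
        have y: "y \<in> upper_ray X r p" "y \<in> X"
          using that V(3) by (auto simp: upper_ray_def)
        then have "y \<notin> lower_ray X r q"
          using True by blast
        then show ?thesis
          using y(2) linear_order_on_linear[OF X mem(2) y(2)] linear_order_on_refl[OF X mem(2)]
          by (auto simp: lower_ray_def)
      qed
      with V(2) have "least V = q"
        unfolding least_def by (intro the_equality) (auto intro: linear_order_on_antisym[OF X])
      then have "q \<in> C"
        using V(1) mem by (auto simp: C_def)
      then show ?thesis
        using pq linear_order_on_refl[OF X mem(2)] by blast
    next
      case False
      then obtain x where x: "x \<in> upper_ray X r p \<inter> lower_ray X r q"
        by blast
      obtain V where V: "V \<in> \<B>" "x \<in> V" "V \<subseteq> upper_ray X r p \<inter> lower_ray X r q"
        using base[OF openin_Int[OF openin_upper_ray[OF mem(1)] openin_lower_ray[OF mem(2)]] x]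
        by blast
      define c where "c = (SOME x. x \<in> V)"
      have "c \<in> V"
        unfolding c_def using V(2) by (rule someI)
      then have c: "c \<in> X" "(p, c) \<in> r" "c \<noteq> p" "(c, q) \<in> r"
        using V(3) by (auto simp: upper_ray_def lower_ray_def)
      moreover have "c \<in> C"
        using V(1) c(1) by (simp add: C_def c_def)
      ultimately show ?thesis
        by blast
    qed
  qed
qed

lemma countable_left_jumps:
  assumes X: "linear_order_on X r" and Y: "linear_order_on Y s"
    and "second_countable (interval_topology Y s)"
    and "f \<in> LOP_maps X r Y s"
  shows "countable {x \<in> X. \<exists>p. (p, f x) \<in> s \<and> p \<noteq> f x \<and> (\<forall>a. (a, x) \<in> r \<and> a \<noteq> x \<longrightarrow> (f a, p) \<in> s)}"
    (is "countable ?B")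
proof -
  obtain C where C: "countable C"
    "\<And>p q. (p, q) \<in> s \<Longrightarrow> p \<noteq> q \<Longrightarrow> \<exists>c\<in>C. (p, c) \<in> s \<and> c \<noteq> p \<and> (c, q) \<in> s"
    using countable_order_dense[OF Y assms(3)] by metis
  \<comment> \<open>The point \<open>c\<close> is chosen in the gap \<open>(p, f x]\<close>. As it
    lies strictly above \<open>p\<close>, it lies strictly above every value taken before
    \<open>x\<close>.\<close>
  have "\<forall>x\<in>?B. \<exists>c. c \<in> C \<and> (c, f x) \<in> s \<and> (\<forall>a. (a, x) \<in> r \<and> a \<noteq> x \<longrightarrow> (f a, c) \<in> s \<and> f a \<noteq> c)"
  proof
    fix x assume "x \<in> ?B"
    then obtain p where p: "(p, f x) \<in> s" "p \<noteq> f x"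
      "\<And>a. (a, x) \<in> r \<Longrightarrow> a \<noteq> x \<Longrightarrow> (f a, p) \<in> s"
      by blast
    from C(2)[OF p(1,2)] obtain c where c: "c \<in> C" "(p, c) \<in> s" "c \<noteq> p" "(c, f x) \<in> s"
      by blast
    have "(f a, c) \<in> s \<and> f a \<noteq> c" if "(a, x) \<in> r" "a \<noteq> x" for a
      using p(3)[OF that] c linear_order_on_trans[OF Y] linear_order_on_antisym[OF Y] by metis
    with c show "\<exists>c. c \<in> C \<and> (c, f x) \<in> s \<and> (\<forall>a. (a, x) \<in> r \<and> a \<noteq> x \<longrightarrow> (f a, c) \<in> s \<and> f a \<noteq> c)"
      by blast
  qed
  from bchoice[OF this] obtain c where
    "\<forall>x\<in>?B. c x \<in> C \<and> (c x, f x) \<in> s \<and> (\<forall>a. (a, x) \<in> r \<and> a \<noteq> x \<longrightarrow> (f a, c x) \<in> s \<and> f a \<noteq> c x)" ..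
  then have c: "x \<in> ?B \<Longrightarrow> c x \<in> C" "x \<in> ?B \<Longrightarrow> (c x, f x) \<in> s"
    "x \<in> ?B \<Longrightarrow> (a, x) \<in> r \<Longrightarrow> a \<noteq> x \<Longrightarrow> (f a, c x) \<in> s \<and> f a \<noteq> c x" for x a
    by blast+
  \<comment> \<open>For jumps \<open>x < y\<close> the choices satisfy
    \<open>c x <= f x < c y\<close>.\<close>
  have neq: "c x \<noteq> c y" if "x \<in> ?B" "y \<in> ?B" "(x, y) \<in> r" "x \<noteq> y" for x y
    using c(2)[OF that(1)] c(3)[OF that(2-4)] linear_order_on_antisym[OF Y] by metis
  have "inj_on c ?B"
  proof (rule inj_onI)
    fix x y assume xy: "x \<in> ?B" "y \<in> ?B" "c x = c y"
    then have "(x, y) \<in> r \<or> (y, x) \<in> r"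
      using linear_order_on_linear[OF X] by blast
    then show "x = y"
      using neq[of x y] neq[of y x] xy by metis
  qed
  moreover have "countable (c ` ?B)"
    by (rule countable_subset[OF image_subsetI C(1)]) (rule c(1))
  ultimately show ?thesis
    using countable_image_inj_on[of c ?B] by blast
qed

text \<open>If \<open>x\<close> is not a left jump and \<open>p < f x\<close>, then some earlier
  \<open>a\<close> already has \<open>p < f a\<close>, and by monotonicity so does a point of the
  dense set in \<open>[a, x)\<close>. At a jump, \<open>x\<close> is its own witness.\<close>

lemma countable_left_witnesses:
  assumes X: "linear_order_on X r" and Y: "linear_order_on Y s"
    and "second_countable (interval_topology X r)" and "second_countable (interval_topology Y s)"
    and f: "f \<in> LOP_maps X r Y s"
  obtains A where "countable A" and "A \<subseteq> X"
    and "\<And>x p. x \<in> X \<Longrightarrow> (p, f x) \<in> s \<Longrightarrow> p \<noteq> f x \<Longrightarrow>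
      \<exists>d\<in>A. (d, x) \<in> r \<and> (p, f d) \<in> s \<and> f d \<noteq> p"
proof -
  \<comment> \<open>In the reversed order, density yields points of the intervals
    \<open>[a, x)\<close>.\<close>
  obtain C where C: "countable C" "C \<subseteq> X"
    "\<And>x a. (x, a) \<in> r\<inverse> \<Longrightarrow> x \<noteq> a \<Longrightarrow> \<exists>c\<in>C. (x, c) \<in> r\<inverse> \<and> c \<noteq> x \<and> (c, a) \<in> r\<inverse>"
    using countable_order_dense[of X "r\<inverse>"] X assms(3)
    by (auto simp: interval_topology_converse simp del: converse_iff)
  \<comment> \<open>For a least element \<open>x\<close> of \<open>X\<close> the condition on
    \<open>a\<close> is vacuous, so \<open>x\<close> is in \<open>B\<close> unless
    \<open>f x\<close> is least in \<open>Y\<close>.\<close>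
  define B where
    "B = {x \<in> X. \<exists>p. (p, f x) \<in> s \<and> p \<noteq> f x \<and> (\<forall>a. (a, x) \<in> r \<and> a \<noteq> x \<longrightarrow> (f a, p) \<in> s)}"
  show thesis
  proof
    show "countable (B \<union> C)"
      using C(1) countable_left_jumps[OF X Y assms(4) f] by (simp add: B_def)
    show "B \<union> C \<subseteq> X"
      using C(2) by (auto simp: B_def)
    fix x p assume x: "x \<in> X" and p: "(p, f x) \<in> s" "p \<noteq> f x"
    show "\<exists>d\<in>B \<union> C. (d, x) \<in> r \<and> (p, f d) \<in> s \<and> f d \<noteq> p"
    proof (cases "x \<in> B")
      case True
      then show ?thesis
        using linear_order_on_refl[OF X x] p by auto
    next
      case False
      then obtain a where a: "(a, x) \<in> r" "a \<noteq> x" "(f a, p) \<notin> s"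
        using x p unfolding B_def by blast
      obtain d where d: "d \<in> C" "(d, x) \<in> r" "(a, d) \<in> r"
        using C(3)[of x a] a by auto
      have mem: "a \<in> X" "d \<in> X"
        using linear_order_on_mem[OF X d(3)] by auto
      then have "(f a, f d) \<in> s" and "f d \<in> Y"
        using f d(3) by (auto simp: LOP_maps_def monotone_on_def)
      then have "(f d, p) \<notin> s"
        using a(3) linear_order_on_trans[OF Y] by blast
      then have "(p, f d) \<in> s" "f d \<noteq> p"
        using linear_order_on_linear[OF Y \<open>f d \<in> Y\<close> linear_order_on_mem(1)[OF Y p(1)]]
          linear_order_on_refl[OF Y \<open>f d \<in> Y\<close>] by auto
      then show ?thesis
        using d by blast
    qed
  qed
qed

section \<open>First countability\<close>

lemma first_countable_LOP_topology:
  assumes X: "linear_order_on X r" and Y: "linear_order_on Y s"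
    and "second_countable (interval_topology X r)" and Y2: "second_countable (interval_topology Y s)"
  shows "first_countable (LOP_topology X r Y s)"
  unfolding first_countable_def topspace_LOP_topology
proof
  fix f assume f: "f \<in> LOP_maps X r Y s"
  let ?M = "LOP_maps X r Y s"
  obtain A1 where A1: "countable A1" "A1 \<subseteq> X"
    "\<And>x p. x \<in> X \<Longrightarrow> (p, f x) \<in> s \<Longrightarrow> p \<noteq> f x \<Longrightarrow>
      \<exists>d\<in>A1. (d, x) \<in> r \<and> (p, f d) \<in> s \<and> f d \<noteq> p"
    using countable_left_witnesses[OF assms f] by metis
  \<comment> \<open>Upper bounds on \<open>f x\<close> come from reversing both orders; these
    witnesses \<open>d\<close> satisfy \<open>x <= d\<close>.\<close>
  obtain A2 where A2: "countable A2" "A2 \<subseteq> X"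
    "\<And>x p. x \<in> X \<Longrightarrow> (p, f x) \<in> s\<inverse> \<Longrightarrow> p \<noteq> f x \<Longrightarrow>
      \<exists>d\<in>A2. (d, x) \<in> r\<inverse> \<and> (p, f d) \<in> s\<inverse> \<and> f d \<noteq> p"
    using countable_left_witnesses[of X "r\<inverse>" Y "s\<inverse>" f] assms f
    by (simp only: linear_order_on_converse interval_topology_converse LOP_maps_converse) metis
  obtain \<B> where \<B>: "countable \<B>" "\<And>V. V \<in> \<B> \<Longrightarrow> openin (interval_topology Y s) V"
    and base: "\<And>U x. openin (interval_topology Y s) U \<Longrightarrow> x \<in> U \<Longrightarrow> \<exists>V\<in>\<B>. x \<in> V \<and> V \<subseteq> U"
    using second_countableE[OF Y2] by metis
  define S where "S = {{g \<in> ?M. g a \<in> V} |a V. a \<in> A1 \<union> A2 \<and> V \<in> \<B> \<and> f a \<in> V}"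
  \<comment> \<open>Intersecting with \<open>?M\<close> turns the empty family into the whole space
    instead of \<open>UNIV\<close>.\<close>
  define N where "N = (\<lambda>F. ?M \<inter> \<Inter>F) ` {F. finite F \<and> F \<subseteq> S}"
  have S_image: "S \<subseteq> (\<lambda>(a, V). {g \<in> ?M. g a \<in> V}) ` ((A1 \<union> A2) \<times> \<B>)"
    by (auto simp: S_def)
  have "countable S"
    by (rule countable_subset[OF S_image]) (use A1(1) A2(1) \<B>(1) in auto)
  then have "countable N"
    unfolding N_def using countable_Collect_finite_subset by blast
  have mono: "(g x, g y) \<in> s" if "g \<in> ?M" "(x, y) \<in> r" for g x y
    using that linear_order_on_mem[OF X that(2)] by (auto simp: LOP_maps_def monotone_on_def)
  have into: "g x \<in> Y" if "g \<in> ?M" "x \<in> X" for g x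
    using that by (auto simp: LOP_maps_def)
  have f_in: "f \<in> V" if "V \<in> N" for V
    using that f by (auto simp: N_def S_def)
  have open_coord: "openin (LOP_topology X r Y s) {g \<in> ?M. g a \<in> V}"
    if "a \<in> X" "openin (interval_topology Y s) V" for a V
  proof -
    have "continuous_map (LOP_topology X r Y s) (interval_topology Y s) (\<lambda>g. g a)"
      unfolding LOP_topology_def
      by (intro continuous_map_from_subtopology continuous_map_product_projection that)
    from openin_continuous_map_preimage[OF this that(2)] show ?thesis
      by simp
  qed
  have N_open: "openin (LOP_topology X r Y s) V" if "V \<in> N" for V
  proof -
    obtain F where F: "finite F" "F \<subseteq> S" "V = \<Inter>(insert ?M F)"
      using \<open>V \<in> N\<close> by (auto simp: N_def)
    have "openin (LOP_topology X r Y s) U" if "U \<in> S" for U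
      using that A1(2) A2(2) \<B>(2) open_coord by (auto simp: S_def)
    then show ?thesis
      unfolding F(3) using F(1,2) openin_topspace[of "LOP_topology X r Y s"]
      by (intro openin_Inter) auto
  qed
  have N_M: "?M \<in> N"
    unfolding N_def by (rule image_eqI[of _ _ "{}"]) auto
  have N_S: "V \<in> N" if "V \<in> S" for V
    unfolding N_def by (rule image_eqI[of _ _ "{V}"]) (use that in \<open>auto simp: S_def\<close>)
  have N_Int: "U \<inter> V \<in> N" if "U \<in> N" "V \<in> N" for U V
  proof -
    obtain F G where "finite F" "F \<subseteq> S" "U = ?M \<inter> \<Inter>F" "finite G" "G \<subseteq> S" "V = ?M \<inter> \<Inter>G"
      using \<open>U \<in> N\<close> \<open>V \<in> N\<close> by (auto simp: N_def)
    then show ?thesis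
      unfolding N_def by (intro image_eqI[of _ _ "F \<union> G"]) auto
  qed
  \<comment> \<open>This is the crucial step: a condition at an arbitrary coordinate
    \<open>x\<close> follows from conditions at coordinates in \<open>A1\<close> and
    \<open>A2\<close>. The induction follows the generation of \<open>U\<close> from the subbase,
    and only the rays need an argument.\<close>
  have coord: "\<exists>V\<in>N. \<forall>g\<in>V. g x \<in> U"
    if "x \<in> X" and U: "openin (interval_topology Y s) U" and fx: "f x \<in> U" for x U
  proof -
    have "generate_topology_on (insert Y (upper_ray Y s ` Y \<union> lower_ray Y s ` Y)) U"
      using U by (simp add: interval_topology_def openin_topology_generated_by_iff)
    then show ?thesis
      using fx
    proof induction
      case Empty
      then show ?case by simp
    next
      case (Int U1 U2)
      then obtain V1 V2 where "V1 \<in> N" "V2 \<in> N" "\<forall>g\<in>V1. g x \<in> U1" "\<forall>g\<in>V2. g x \<in> U2"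
        by auto
      then show ?case
        using N_Int[of V1 V2] by blast
    next
      case (UN K)
      from UN.prems obtain k where k: "k \<in> K" "f x \<in> k"
        by blast
      show ?case
        using UN.IH[OF k] k(1) by blast
    next
      case (Basis U)
      then consider "U = Y" | p where "p \<in> Y" "U = upper_ray Y s p"
        | p where "p \<in> Y" "U = lower_ray Y s p"
        by blast
      then show ?case
      proof cases
        case 1
        then show ?thesis
          using N_M into \<open>x \<in> X\<close> by blast
      next
        case 2
        then have "(p, f x) \<in> s" "p \<noteq> f x"
          using Basis(2) by (auto simp: upper_ray_def)
        from A1(3)[OF \<open>x \<in> X\<close> this] obtain d
          where d: "d \<in> A1" "(d, x) \<in> r" "(p, f d) \<in> s" "f d \<noteq> p"
          by blast
        then have "f d \<in> U"
          using 2 into[OF f, of d] A1(2) by (auto simp: upper_ray_def)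
        \<comment> \<open>\<open>S\<close> admits only members of the countable base, so the ray is
          shrunk to one of them around \<open>f d\<close>.\<close>
        then obtain V where V: "V \<in> \<B>" "f d \<in> V" "V \<subseteq> U"
          using base[of U "f d"] openin_upper_ray[OF 2(1)] 2(2) by blast
        have "{g \<in> ?M. g d \<in> V} \<in> N"
          using d(1) V by (intro N_S) (auto simp: S_def)
        \<comment> \<open>Here \<open>p < g d <= g x\<close>, because \<open>d <= x\<close>.\<close>
        moreover have "g x \<in> U" if "g \<in> ?M" "g d \<in> V" for g
          using upper_ray_upward[OF Y _ mono[OF that(1) d(2)], of p] that(2) V(3) 2(2) by blast
        ultimately show ?thesis
          by (intro bexI[of _ "{g \<in> ?M. g d \<in> V}"]) simp_all
      next
        case 3
        then have "(p, f x) \<in> s\<inverse>" "p \<noteq> f x"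
          using Basis(2) by (auto simp: lower_ray_def)
        from A2(3)[OF \<open>x \<in> X\<close> this] obtain d
          where d: "d \<in> A2" "(x, d) \<in> r" "(f d, p) \<in> s" "f d \<noteq> p"
          by blast
        then have "f d \<in> U"
          using 3 into[OF f, of d] A2(2) by (auto simp: lower_ray_def)
        then obtain V where V: "V \<in> \<B>" "f d \<in> V" "V \<subseteq> U"
          using base[of U "f d"] openin_lower_ray[OF 3(1)] 3(2) by blast
        have "{g \<in> ?M. g d \<in> V} \<in> N"
          using d(1) V by (intro N_S) (auto simp: S_def)
        \<comment> \<open>Dually, \<open>g x <= g d < p\<close>, because
          \<open>x <= d\<close>.\<close>
        moreover have "g x \<in> U" if "g \<in> ?M" "g d \<in> V" for g
          using lower_ray_downward[OF Y _ mono[OF that(1) d(2)], of p] that(2) V(3) 3(2) by blast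
        ultimately show ?thesis
          by (intro bexI[of _ "{g \<in> ?M. g d \<in> V}"]) simp_all
      qed
    qed
  qed
  have local_base: "\<exists>V\<in>N. f \<in> V \<and> V \<subseteq> U" if U: "openin (LOP_topology X r Y s) U" "f \<in> U" for U
  proof -
    obtain W where W: "openin (product_topology (\<lambda>_. interval_topology Y s) X) W" "U = W \<inter> ?M"
      using U(1) unfolding LOP_topology_def openin_subtopology by blast
    then have "f \<in> W"
      using U(2) by blast
    with W(1) obtain Z where Z: "finite {x \<in> X. Z x \<noteq> Y}"
      "\<And>x. x \<in> X \<Longrightarrow> openin (interval_topology Y s) (Z x)" "f \<in> Pi\<^sub>E X Z" "Pi\<^sub>E X Z \<subseteq> W"
      unfolding openin_product_topology_alt topspace_interval_topology by metis
    \<comment> \<open>A basic open box restricts only finitely many coordinates, so finitely many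
      applications of \<open>coord\<close> can be intersected within \<open>N\<close>. At the other
      coordinates \<open>Z x = Y\<close> holds.\<close>
    have "\<exists>V\<in>N. \<forall>g\<in>V. \<forall>x\<in>F. g x \<in> Z x" if "finite F" "F \<subseteq> X" for F
      using that
    proof (induction F rule: finite_induct)
      case empty
      then show ?case using N_M by blast
    next
      case (insert x F)
      then obtain V where V: "V \<in> N" "\<forall>g\<in>V. \<forall>x\<in>F. g x \<in> Z x"
        by auto
      obtain V' where V': "V' \<in> N" "\<forall>g\<in>V'. g x \<in> Z x"
        using coord[of x "Z x"] insert.prems Z(2,3) by (auto simp: PiE_iff)
      show ?case
        by (rule bexI[OF _ N_Int[OF V(1) V'(1)]]) (use V(2) V'(2) in simp)
    qed
    from this[OF Z(1)] obtain V where
      V: "V \<in> N" "\<And>g x. g \<in> V \<Longrightarrow> x \<in> X \<Longrightarrow> Z x \<noteq> Y \<Longrightarrow> g x \<in> Z x"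
      by auto
    have "V \<subseteq> U"
    proof
      fix g assume g: "g \<in> V"
      then have gM: "g \<in> ?M"
        using V(1) by (auto simp: N_def)
      have "g x \<in> Z x" if "x \<in> X" for x
        using V(2)[OF g that] into[OF gM that] by blast
      then have "g \<in> Pi\<^sub>E X Z"
        using gM by (auto simp: LOP_maps_def PiE_iff)
      then show "g \<in> U"
        using Z(4) W(2) gM by blast
    qed
    then show ?thesis
      using V(1) f_in by blast
  qed
  show "\<exists>\<B>. countable \<B> \<and> (\<forall>V\<in>\<B>. openin (LOP_topology X r Y s) V) \<and>
      (\<forall>U. openin (LOP_topology X r Y s) U \<and> f \<in> U \<longrightarrow> (\<exists>V\<in>\<B>. f \<in> V \<and> V \<subseteq> U))"
    using \<open>countable N\<close> N_open local_base by blast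
qed

section \<open>Compactness\<close>

text \<open>If no point lies strictly between \<open>a\<close> and \<open>b\<close>, the rays below
  \<open>b\<close> and above \<open>a\<close> split \<open>Y\<close>; otherwise the two rays at an
  intermediate point do the separating. Beyond disjointness, all of \<open>U\<close> lies below all
  of \<open>V\<close>, which expresses that the order is closed.\<close>

lemma separating_rays:
  assumes Y: "linear_order_on Y s" and "(a, b) \<in> s" and "a \<noteq> b"
  obtains U V where "openin (interval_topology Y s) U" and "openin (interval_topology Y s) V"
    and "a \<in> U" and "b \<in> V" and "\<And>u v. u \<in> U \<Longrightarrow> v \<in> V \<Longrightarrow> (v, u) \<notin> s"
proof -
  note mem = linear_order_on_mem[OF Y assms(2)]
  show thesis
  proof (cases "upper_ray Y s a \<inter> lower_ray Y s b = {}")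
    case True
    show thesis
    proof (rule that[OF openin_lower_ray[OF mem(2)] openin_upper_ray[OF mem(1)]])
      show "a \<in> lower_ray Y s b" "b \<in> upper_ray Y s a"
        using assms mem by (auto simp: upper_ray_def lower_ray_def)
      show "(v, u) \<notin> s" if "u \<in> lower_ray Y s b" "v \<in> upper_ray Y s a" for u v
        using lower_ray_downward[OF Y that(1)] that(2) True by blast
    qed
  next
    case False
    then obtain c where c: "c \<in> Y" "a \<in> lower_ray Y s c" "b \<in> upper_ray Y s c"
      using mem by (auto simp: upper_ray_def lower_ray_def)
    show thesis
    proof (rule that[OF openin_lower_ray[OF c(1)] openin_upper_ray[OF c(1)] c(2,3)])
      show "(v, u) \<notin> s" if "u \<in> lower_ray Y s c" "v \<in> upper_ray Y s c" for u v
        using lower_ray_downward[OF Y that(1)] that(2) rays_disjoint[OF Y] by blast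
    qed
  qed
qed

text \<open>Failure of monotonicity shows at a single pair \<open>x <= y\<close> with
  \<open>f y < f x\<close>. Separating these two values gives an open condition on two coordinates
  that no monotone map satisfies.\<close>

lemma closedin_LOP_maps:
  assumes Y: "linear_order_on Y s"
  shows "closedin (product_topology (\<lambda>_. interval_topology Y s) X) (LOP_maps X r Y s)"
proof -
  let ?P = "product_topology (\<lambda>_. interval_topology Y s) X"
  have "openin ?P (topspace ?P - LOP_maps X r Y s)"
  proof (subst openin_subopen, intro ballI)
    fix f assume f: "f \<in> topspace ?P - LOP_maps X r Y s"
    then obtain x y where xy: "x \<in> X" "y \<in> X" "(x, y) \<in> r" "(f x, f y) \<notin> s"
      by (auto simp: LOP_maps_def monotone_on_def)
    have fY: "f x \<in> Y" "f y \<in> Y"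
      using f xy by auto
    have "(f y, f x) \<in> s" "f y \<noteq> f x"
      using xy(4) linear_order_on_linear[OF Y fY] linear_order_on_refl[OF Y fY(1)] by auto
    from separating_rays[OF Y this] obtain U V where
      UV: "openin (interval_topology Y s) U" "openin (interval_topology Y s) V" "f y \<in> U" "f x \<in> V"
        "\<And>u v. u \<in> U \<Longrightarrow> v \<in> V \<Longrightarrow> (v, u) \<notin> s"
      by metis
    let ?W = "{g \<in> topspace ?P. g y \<in> U} \<inter> {g \<in> topspace ?P. g x \<in> V}"
    have "openin ?P ?W"
      by (intro openin_Int openin_continuous_map_preimage[OF continuous_map_product_projection]
          xy UV)
    moreover have "f \<in> ?W"
      using f UV by blast
    moreover have "?W \<subseteq> topspace ?P - LOP_maps X r Y s"
      using UV(5) xy(1-3) by (fastforce simp: LOP_maps_def monotone_on_def)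
    ultimately show "\<exists>T. openin ?P T \<and> f \<in> T \<and> T \<subseteq> topspace ?P - LOP_maps X r Y s"
      by blast
  qed
  moreover have "LOP_maps X r Y s \<subseteq> topspace ?P"
    by (auto simp: LOP_maps_def)
  ultimately show ?thesis
    by (simp add: closedin_def)
qed

lemma compact_space_LOP_topology:
  assumes "linear_order_on Y s" and "compact_space (interval_topology Y s)"
  shows "compact_space (LOP_topology X r Y s)"
  unfolding LOP_topology_def using assms
  by (intro compact_space_subtopology closedin_compact_space closedin_LOP_maps)
    (auto simp: compact_space_product_topology)

theorem theorem4p11:
  fixes X :: "'a set" and r :: "'a rel" and Y :: "'b set" and s :: "'b rel"
  assumes "linear_order_on X r" and "linear_order_on Y s"
    and "compact_space (interval_topology X r)" and "metrizable_space (interval_topology X r)"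
    and "compact_space (interval_topology Y s)" and "metrizable_space (interval_topology Y s)"
  shows "first_countable (LOP_topology X r Y s) \<and> compact_space (LOP_topology X r Y s)"
  using assms by (simp add: first_countable_LOP_topology compact_space_LOP_topology
      compact_metrizable_imp_second_countable)

end
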